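(* In the setting described in the context, let the global model be updated by $\mathbf{w}^{(t+1)}=\mathbf{w}^{(t)}-\alpha^{(t)}\tilde{\mathbf{g}}^{(t)}$ with learning rate $\alpha^{(t)}=\frac{1}{\sqrt{T}L}$, where $T$ is the number of global rounds. Then the loss function degradation after an arbitrary training round $t$ is bounded by $$\mathbb{E}\big[\mathcal{F}(\mathbf{w}^{(t)})-\mathcal{F}(\mathbf{w}^{(t+1)})\big]\ge\Big(\frac{1}{\sqrt{T}L}-\frac{1}{2TL}\Big)\|\mathbf{g}^{(t)}\|^2-\frac{1}{2TL}\bigg\{\frac{\delta_u^2}{\eta^{(t)}}+\sum_{k=1}^K\frac{b_k^{(t)}}{(b^{(t)})^2}\Big[\sigma^2+A^2\Big(\delta_{k,c}^2+\frac{\delta_s^2}{P_{k,s}^{(t)}}\Big)\Big]\bigg\}.$$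
   Context: Model (over-the-air federated edge learning with wireless sensing). There are $K$ devices and a server. In round $t$ the server broadcasts the global model $\mathbf{w}^{(t)}$ to all devices, and $\mathbf{w}_k^{(t)}$ denotes the local model of device $k$ in round $t$. Device $k$ obtains a batch of $b_k^{(t)}$ sensing data samples with sensing power $P_{k,s}^{(t)}$; $b^{(t)}=\sum_{k=1}^Kb_k^{(t)}$ is the total batch size. The $i$-th obtained sample is $\hat{\mathbf{x}}_{k,i}^{(t)}=\mathbf{x}_{k,i}^{(t)}+\mathbf{c}_k^{(t)}+\mathbf{n}_s^{(t)}/\sqrt{P_{k,s}^{(t)}}$, where $\mathbf{x}_{k,i}^{(t)}$ is the ground-true (clean) sample, $\mathbf{c}_k^{(t)}$ is the residual sensing clutter, zero-mean multivariate Gaussian with $\mathbb{E}({\mathbf{c}_k^{(t)}}^H\mathbf{c}_k^{(t)})=\delta_{k,c}^2$, and $\mathbf{n}_s^{(t)}$ is the sensing noise, zero-mean Gaussian with $\mathbb{E}({\mathbf{n}_s^{(t)}}^H\mathbf{n}_s^{(t)})=\delta_s^2$. The local gradients are aggregated over the air with receive signal power $\eta^{(t)}$ and additive white Gaussian channel noise $\mathbf{n}_u^{(t)}$ with $\mathbb{E}({\mathbf{n}_u^{(t)}}^H\mathbf{n}_u^{(t)})=\delta_u^2$. Let $\mathcal{F}(\mathbf{w};\mathbf{x})$ be the sample loss and $\mathcal{F}(\mathbf{w})$ the loss function of the model, $\mathbf{g}_{k,i}^{(t)}=\nabla_{\mathbf{w}_k^{(t)}}\mathcal{F}(\mathbf{w}_k^{(t)};\mathbf{x}_{k,i}^{(t)})$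 the stochastic gradient from the clean sample, $\mathbf{H}(\mathbf{w};\mathbf{x})=\nabla_{\mathbf{w}}(\nabla_{\mathbf{x}}\mathcal{F}(\mathbf{w};\mathbf{x}))$ the matrix of mixed second derivatives, and $\hat{\mathbf{H}}_{k,i}^{(t)}=\mathbf{H}(\mathbf{w}_k^{(t)};\mathbf{x}_{k,i}^{(t)})$. Ignoring higher-order terms in the Taylor expansion of the gradient in the data noise, the global gradient recovered at the server is $$\tilde{\mathbf{g}}^{(t)}=\frac{1}{b^{(t)}}\sum_{k=1}^K\sum_{i=1}^{b_k^{(t)}}\Big[\mathbf{g}_{k,i}^{(t)}+\hat{\mathbf{H}}_{k,i}^{(t)}\Big(\mathbf{c}_k^{(t)}+\frac{\mathbf{n}_s^{(t)}}{\sqrt{P_{k,s}^{(t)}}}\Big)\Big]+\frac{\mathbf{n}_u^{(t)}}{\sqrt{\eta^{(t)}}}.$$ Assumptions: (1) $\|\mathbf{H}(\mathbf{w};\mathbf{x})\|_F\le A$ (Frobenius norm) for all $\mathbf{w},\mathbf{x}$; (2) $\mathbb{E}(\mathbf{g}_{k,i}^{(t)})=\mathbf{g}^{(t)}$ and $\mathbb{E}[\|\mathbf{g}_{k,i}^{(t)}-\mathbf{g}^{(t)}\|^2]\le\sigma^2$, where $\mathbf{g}^{(t)}$ is the ground-truth gradient vector in round $t$ (the gradient $\nabla\mathcal{F}(\mathbf{w}^{(t)})$); (3) $\mathcal{F}(\mathbf{w})\ge\mathcal{F}^*$ for all $\mathbf{w}$; (4) $\mathcal{F}$ is $L$-smooth: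 $\mathcal{F}(\mathbf{v})\le\mathcal{F}(\mathbf{w})+(\mathbf{v}-\mathbf{w})^\top\nabla\mathcal{F}(\mathbf{w})+\frac L2\|\mathbf{v}-\mathbf{w}\|^2$ for all $\mathbf{v},\mathbf{w}$.
   Formalization: Clutter and sensing noise are drawn afresh for every sample, and all samples, clutters, sensing noises and the channel noise of the round are assumed jointly independent; with one shared clutter draw per batch, or with fully dependent samples, the stated bound fails. *)

theory Defs
  imports "HOL-Probability.Probability"
begin

text \<open>Model parameters live in \<open>real ^ 'p\<close>, sensing data in \<open>real ^ 'd\<close>, so that the
  Hermitian product of a vector with itself is \<open>(norm v)\<^sup>2\<close>.\<close>

definition grad :: "('a::real_inner \<Rightarrow> real) \<Rightarrow> 'a \<Rightarrow> 'a" where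
  "grad \<phi> x = (THE D. GDERIV \<phi> x :> D)"

lemma grad_eqI:
  assumes "GDERIV \<phi> x :> D"
  shows "grad \<phi> x = D"
  unfolding grad_def
proof (rule the_equality[where P = "\<lambda>D. GDERIV \<phi> x :> D", OF assms])
  fix D' assume "GDERIV \<phi> x :> D'"
  then have "(\<lambda>h. inner h D') = (\<lambda>h. inner h D)"
    using assms unfolding gderiv_def by (rule has_derivative_unique)
  then show "D' = D"
    by (metis inner_commute vector_eq_ldot)
qed

lemma grad_gderiv:
  fixes \<phi> :: "'a::euclidean_space \<Rightarrow> real"
  assumes "\<phi> differentiable (at x)"
  shows "GDERIV \<phi> x :> grad \<phi> x"
proof -
  from assms obtain f' where f': "(\<phi> has_derivative f') (at x)"
    by (auto simp: differentiable_def)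
  then interpret bounded_linear f'
    by (rule has_derivative_bounded_linear)
  have "f' = (\<lambda>h. inner h (\<Sum>b\<in>Basis. f' b *\<^sub>R b))"
  proof
    fix h
    have "f' h = f' (\<Sum>b\<in>Basis. inner h b *\<^sub>R b)"
      by (simp add: euclidean_representation)
    also have "\<dots> = inner h (\<Sum>b\<in>Basis. f' b *\<^sub>R b)"
      by (simp add: sum scaleR inner_sum_right mult.commute)
    finally show "f' h = inner h (\<Sum>b\<in>Basis. f' b *\<^sub>R b)" .
  qed
  with f' have "GDERIV \<phi> x :> (\<Sum>b\<in>Basis. f' b *\<^sub>R b)"
    unfolding gderiv_def by metis
  then show ?thesis
    by (simp add: grad_eqI)
qed

text \<open>Row \<open>i\<close>, column \<open>j\<close> holds the derivative with respect to the \<open>i\<close>-th parameter of the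
  derivative of the sample loss with respect to the \<open>j\<close>-th data coordinate. The library norm of
  a matrix in \<open>real ^ 'd ^ 'p\<close> is its Frobenius norm (see \<open>norm_matrix_frobenius\<close>).\<close>

definition mixed_hessian ::
    "(real ^ 'p \<Rightarrow> real ^ 'd \<Rightarrow> real) \<Rightarrow> real ^ 'p \<Rightarrow> real ^ 'd \<Rightarrow> real ^ 'd ^ 'p" where
  "mixed_hessian f w x = (\<chi> i j. grad (\<lambda>v. grad (f v) x $ j) w $ i)"

lemma norm_matrix_frobenius:
  "norm (H :: real ^ 'd ^ 'p) = sqrt (\<Sum>i\<in>UNIV. \<Sum>j\<in>UNIV. (H $ i $ j)\<^sup>2)"
  by (simp add: norm_vec_def L2_set_def sum_nonneg)

text \<open>A random vector is Gaussian iff all its linear functionals are normal. Degenerate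
  (almost surely constant) functionals are allowed, so singular covariances are covered.\<close>

definition normal_rv :: "'s measure \<Rightarrow> ('s \<Rightarrow> real) \<Rightarrow> real \<Rightarrow> bool" where
  "normal_rv M Z \<mu> \<longleftrightarrow>
     (\<exists>s>0. distributed M lborel Z (\<lambda>z. ennreal (normal_density \<mu> s z))) \<or>
     (AE \<omega> in M. Z \<omega> = \<mu>)"

definition gaussian_vector ::
    "'s measure \<Rightarrow> ('s \<Rightarrow> 'a::euclidean_space) \<Rightarrow> 'a \<Rightarrow> bool" where
  "gaussian_vector M X \<mu> \<longleftrightarrow>
     X \<in> borel_measurable M \<and> (\<forall>a. normal_rv M (\<lambda>\<omega>. inner a (X \<omega>)) (inner a \<mu>))"

text \<open>For a zero-mean \<open>X\<close>: the covariance matrix is a multiple of the identity.\<close>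

definition white :: "'s measure \<Rightarrow> ('s \<Rightarrow> 'a::euclidean_space) \<Rightarrow> bool" where
  "white M X \<longleftrightarrow>
     (\<exists>v. \<forall>a b. (\<integral>\<omega>. inner a (X \<omega>) * inner b (X \<omega>) \<partial>M) = v * inner a b)"

text \<open>The random inputs of one round. Their value types differ, so joint independence is stated
  by \<open>indep_sets\<close> on the generated families of events, which is what \<open>indep_vars\<close>
  unfolds to when the value types agree.\<close>

datatype source = Sample nat nat | Clutter nat nat | Sensing_Noise nat nat | Channel_Noise

definition sources :: "nat \<Rightarrow> (nat \<Rightarrow> nat) \<Rightarrow> source set" where
  "sources K b =
     (\<Union>k\<in>{1..K}. \<Union>i\<in>{1..b k}. {Sample k i, Clutter k i, Sensing_Noise k i}) \<union>
     {Channel_Noise}"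

definition rv_events :: "'s measure \<Rightarrow> ('s \<Rightarrow> 'a::topological_space) \<Rightarrow> 's set set" where
  "rv_events M X = {X -` B \<inter> space M | B. B \<in> sets borel}"

definition independent_inputs ::
    "'s measure \<Rightarrow> nat \<Rightarrow> (nat \<Rightarrow> nat) \<Rightarrow>
     (nat \<Rightarrow> nat \<Rightarrow> 's \<Rightarrow> real ^ 'd) \<Rightarrow> (nat \<Rightarrow> nat \<Rightarrow> 's \<Rightarrow> real ^ 'd) \<Rightarrow>
     (nat \<Rightarrow> nat \<Rightarrow> 's \<Rightarrow> real ^ 'd) \<Rightarrow> ('s \<Rightarrow> real ^ 'p) \<Rightarrow> bool" where
  "independent_inputs M K b x c n\<^sub>s n\<^sub>u \<longleftrightarrow>
     prob_space.indep_sets M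
       (\<lambda>j. case j of
          Sample k i \<Rightarrow> rv_events M (x k i)
        | Clutter k i \<Rightarrow> rv_events M (c k i)
        | Sensing_Noise k i \<Rightarrow> rv_events M (n\<^sub>s k i)
        | Channel_Noise \<Rightarrow> rv_events M n\<^sub>u)
       (sources K b)"

definition total_batch :: "nat \<Rightarrow> (nat \<Rightarrow> nat) \<Rightarrow> nat" where
  "total_batch K b = (\<Sum>k=1..K. b k)"

text \<open>The data noise enters to first order only. Clutter and sensing noise carry a sample index:
  every sensing sample has its own realisation of them. With one realisation shared by a batch
  the noise would not average out over the batch.\<close>

definition recovered_gradient ::
    "nat \<Rightarrow> (nat \<Rightarrow> nat) \<Rightarrow> (nat \<Rightarrow> real) \<Rightarrow> real \<Rightarrow>
     (real ^ 'p \<Rightarrow> real ^ 'd \<Rightarrow> real) \<Rightarrow> (nat \<Rightarrow> real ^ 'p) \<Rightarrow>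
     (nat \<Rightarrow> nat \<Rightarrow> real ^ 'd) \<Rightarrow> (nat \<Rightarrow> nat \<Rightarrow> real ^ 'd) \<Rightarrow>
     (nat \<Rightarrow> nat \<Rightarrow> real ^ 'd) \<Rightarrow> real ^ 'p \<Rightarrow> real ^ 'p" where
  "recovered_gradient K b P \<eta> f w x c n\<^sub>s n\<^sub>u =
     (1 / real (total_batch K b)) *\<^sub>R
       (\<Sum>k=1..K. \<Sum>i=1..b k.
          grad (\<lambda>v. f v (x k i)) (w k) +
          mixed_hessian f (w k) (x k i) *v (c k i + (1 / sqrt (P k)) *\<^sub>R n\<^sub>s k i)) +
     (1 / sqrt \<eta>) *\<^sub>R n\<^sub>u"

end

theory Submission
  imports Defs
begin

text \<open>The recovered gradient is the true gradient plus one error term per source: the sampling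
  error, the clutter and the sensing noise (both pushed through the Hessian of the sample) of each
  sample, and the channel noise. Every term has mean zero and any two are orthogonal, since one of
  the two can be chosen so that the other is determined by sources independent of its own noise. So
  the second moment of the total error is the sum of the individual ones, where the averaging
  factor enters squared. Inserting first and second moment into the smoothness inequality gives
  the bound. Lower boundedness of the loss makes the loss degradation integrable.\<close>

subsection \<open>Measurability of gradients and Hessians\<close>

text \<open>The error terms are not functions of independent variables: the Hessian in front of a
  clutter or sensing noise vector is evaluated at the sample that also determines the sampling
  error, and the two noises of one sample share that Hessian. Orthogonality therefore comes from
  linearity in the noise. By \<open>inner Q (H *v y) = inner (Q v* H) y\<close> the zero-mean vector
  \<open>y\<close> ends up alone, against a factor independent of it, and the bound \<open>A\<close>
  keeps that factor square-integrable. A second obstacle is measurability. Gradients are definite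
  descriptions, and the sample loss is only assumed differentiable in each argument, so gradient and
  Hessian have to be exhibited as limits of measurable functions of the data before any independence
  argument can start.\<close>

lemma norm_matrix_vector_mult_le:
  fixes H :: "real ^ 'd ^ 'p"
  shows "norm (H *v y) \<le> norm H * norm y"
proof -
  have "norm (H *v y) = L2_set (\<lambda>i. norm ((H *v y) $ i)) UNIV"
    by (simp add: norm_vec_def)
  \<comment> \<open>Cauchy-Schwarz in each row; the Frobenius norm is the Euclidean norm of the row
    norms.\<close>
  also have "\<dots> \<le> L2_set (\<lambda>i. norm (H $ i) * norm y) UNIV"
    by (rule L2_set_mono)
      (auto simp: matrix_vector_mul_component intro: Cauchy_Schwarz_ineq2)
  also have "\<dots> = norm H * norm y"
    by (simp add: L2_set_left_distrib norm_vec_def)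
  finally show ?thesis .
qed

text \<open>The adjoint inherits the Frobenius bound by duality: pairing \<open>v\<close> with
  \<open>H *v (v v* H)\<close> yields the squared norm of \<open>v v* H\<close>, and one factor
  cancels unless it is zero. This controls the Hessian after it has been moved off the
  noise.\<close>

lemma norm_vector_matrix_mult_le:
  fixes H :: "real ^ 'd ^ 'p"
  shows "norm (v v* H) \<le> norm H * norm v"
proof (cases "v v* H = 0")
  case False
  have "(norm (v v* H))\<^sup>2 = inner v (H *v (v v* H))"
    by (simp add: power2_norm_eq_inner dot_lmul_matrix)
  also have "\<dots> \<le> norm v * norm (H *v (v v* H))"
    by (rule norm_cauchy_schwarz)
  also have "\<dots> \<le> norm v * (norm H * norm (v v* H))"
    by (intro mult_left_mono norm_matrix_vector_mult_le) simp
  finally have "norm (v v* H) * norm (v v* H) \<le> (norm H * norm v) * norm (v v* H)"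
    by (simp add: power2_eq_square mult_ac)
  then show ?thesis
    using False by (simp only: mult_le_cancel_right) auto
qed simp

lemma borel_measurable_vec_nth:
  "(\<lambda>v :: 'a::euclidean_space ^ 'i. v $ i) \<in> borel_measurable borel"
  by (intro borel_measurable_continuous_onI continuous_intros)

lemma borel_measurable_vec_lambda:
  fixes f :: "'i::finite \<Rightarrow> 's \<Rightarrow> 'a::euclidean_space"
  assumes "\<And>i. f i \<in> borel_measurable N"
  shows "(\<lambda>\<omega>. \<chi> i. f i \<omega>) \<in> borel_measurable N"
proof (subst borel_measurable_euclidean_space, rule ballI)
  fix e :: "'a ^ 'i" assume "e \<in> Basis"
  then obtain i u where "e = axis i u"
    by (auto simp: Basis_vec_def)
  then show "(\<lambda>\<omega>. inner (\<chi> i. f i \<omega>) e) \<in> borel_measurable N"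
    using assms by (simp add: inner_axis)
qed

lemma borel_measurable_matrix_vector_mult:
  fixes H :: "'s \<Rightarrow> real ^ 'd ^ 'p"
  assumes "H \<in> borel_measurable N" "y \<in> borel_measurable N"
  shows "(\<lambda>\<omega>. H \<omega> *v y \<omega>) \<in> borel_measurable N"
proof -
  have "(\<lambda>\<omega>. inner (H \<omega> $ i) (y \<omega>)) \<in> borel_measurable N" for i
    using assms by (intro borel_measurable_inner measurable_compose[OF _ borel_measurable_vec_nth])
  then have "(\<lambda>\<omega>. \<chi> i. inner (H \<omega> $ i) (y \<omega>)) \<in> borel_measurable N"
    by (rule borel_measurable_vec_lambda)
  then show ?thesis
    by (simp add: vec_eq_iff matrix_vector_mul_component[symmetric])
qed

lemma borel_measurable_vector_matrix_mult:
  fixes H :: "'s \<Rightarrow> real ^ 'd ^ 'p"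
  assumes "H \<in> borel_measurable N" "v \<in> borel_measurable N"
  shows "(\<lambda>\<omega>. v \<omega> v* H \<omega>) \<in> borel_measurable N"
proof -
  have "(\<lambda>\<omega>. H \<omega> $ i $ j) \<in> borel_measurable N" "(\<lambda>\<omega>. v \<omega> $ i) \<in> borel_measurable N" for i j
    by (rule measurable_compose[OF measurable_compose[OF assms(1) borel_measurable_vec_nth] borel_measurable_vec_nth]
        measurable_compose[OF assms(2) borel_measurable_vec_nth])+
  then show ?thesis
    unfolding vector_matrix_mult_def
    by (intro borel_measurable_vec_lambda borel_measurable_sum borel_measurable_times)
qed

text \<open>The directional derivative is reached along a sequence of steps rather than a continuous
  parameter, because measurability passes to sequential limits.\<close>

lemma gderiv_difference_quotient:
  assumes "GDERIV \<phi> x :> D"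
  shows "(\<lambda>n. (\<phi> (x + (1 / real (Suc n)) *\<^sub>R u) - \<phi> x) * real (Suc n)) \<longlonglongrightarrow> inner D u"
proof -
  have "((\<lambda>s. \<phi> (x + s *\<^sub>R u)) has_derivative (\<lambda>s. inner (s *\<^sub>R u) D)) (at 0)"
  proof (rule has_derivative_compose[where f = "\<lambda>s. x + s *\<^sub>R u" and g = \<phi>])
    show "((\<lambda>s. x + s *\<^sub>R u) has_derivative (\<lambda>s. s *\<^sub>R u)) (at 0)"
      by (auto intro!: derivative_eq_intros)
    show "(\<phi> has_derivative (\<lambda>h. inner h D)) (at (x + 0 *\<^sub>R u))"
      using assms by (simp add: gderiv_def)
  qed
  then have "((\<lambda>s. \<phi> (x + s *\<^sub>R u)) has_field_derivative inner D u) (at 0)"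
    by (simp add: has_field_derivative_def inner_commute mult.commute[of _ "inner D u"])
  then have lim: "((\<lambda>s. (\<phi> (x + s *\<^sub>R u) - \<phi> x) / s) \<longlongrightarrow> inner D u) (at 0)"
    by (simp add: DERIV_def)
  \<comment> \<open>\<open>Suc n\<close> makes every step well defined and nonzero, as the punctured
    limit at 0 requires.\<close>
  have "filterlim (\<lambda>n. 1 / real (Suc n)) (at 0) sequentially"
    using LIMSEQ_inverse_real_of_nat
    by (auto simp: filterlim_at inverse_eq_divide)
  from filterlim_compose[OF lim this] show ?thesis
    by simp
qed

text \<open>Each coordinate is a pointwise limit of difference quotients. The base point
  \<open>p z\<close> may move with \<open>z\<close>: the identity serves gradients in the data, a
  constant serves gradients in the parameters while the data vary.\<close>

lemma borel_measurable_grad: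
  fixes \<phi> :: "'s \<Rightarrow> 'a::euclidean_space \<Rightarrow> real"
  assumes diff: "\<And>z. z \<in> space N \<Longrightarrow> \<phi> z differentiable (at (p z))"
    and meas: "\<And>u. (\<lambda>z. \<phi> z (p z + u)) \<in> borel_measurable N"
  shows "(\<lambda>z. grad (\<phi> z) (p z)) \<in> borel_measurable N"
proof (subst borel_measurable_euclidean_space, rule ballI)
  fix e :: 'a
  show "(\<lambda>z. inner (grad (\<phi> z) (p z)) e) \<in> borel_measurable N"
  proof (rule borel_measurable_LIMSEQ_real)
    show "(\<lambda>n. (\<phi> z (p z + (1 / real (Suc n)) *\<^sub>R e) - \<phi> z (p z)) * real (Suc n))
        \<longlonglongrightarrow> inner (grad (\<phi> z) (p z)) e" if "z \<in> space N" for z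
      by (rule gderiv_difference_quotient[OF grad_gderiv[OF diff[OF that]]])
    show "(\<lambda>z. (\<phi> z (p z + (1 / real (Suc n)) *\<^sub>R e) - \<phi> z (p z)) * real (Suc n))
        \<in> borel_measurable N" for n
      using meas[of "(1 / real (Suc n)) *\<^sub>R e"] meas[of 0]
      by (intro borel_measurable_times borel_measurable_diff) auto
  qed
qed

lemma borel_measurable_differentiable:
  fixes \<phi> :: "'a::euclidean_space \<Rightarrow> real"
  assumes "\<And>y. \<phi> differentiable (at y)"
  shows "\<phi> \<in> borel_measurable borel"
  using assms
  by (auto intro!: borel_measurable_continuous_onI
      simp: continuous_on_eq_continuous_at differentiable_imp_continuous_within)

text \<open>The limit argument is applied twice: to the data gradient, at every parameter
  \<open>v\<close>, and then to its coordinates as functions of the parameter at the fixed point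
  \<open>w\<close>. The second round needs the first at all parameters near \<open>w\<close>, not
  just at \<open>w\<close>.\<close>

lemma borel_measurable_mixed_hessian:
  fixes f :: "real ^ 'p \<Rightarrow> real ^ 'd \<Rightarrow> real"
  assumes dx: "\<And>v y. f v differentiable (at y)"
    and dxw: "\<And>v y. (\<lambda>u. grad (f u) y) differentiable (at v)"
  shows "mixed_hessian f w \<in> borel_measurable borel"
proof -
  have "(\<lambda>y. grad (f v) y) \<in> borel_measurable borel" for v
  proof (rule borel_measurable_grad[where p = "\<lambda>y. y"])
    show "(\<lambda>y. f v (y + u)) \<in> borel_measurable borel" for u
      by (rule measurable_compose[OF _ borel_measurable_differentiable[OF dx]]) simp
  qed (rule dx)
  then have "(\<lambda>y. grad (f v) y $ j) \<in> borel_measurable borel" for v j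
    by (rule measurable_compose[OF _ borel_measurable_vec_nth])
  moreover have "(\<lambda>v. grad (f v) y $ j) differentiable (at w)" for y j
    using dxw[of y w]
    by (auto simp: differentiable_def intro: bounded_linear.has_derivative[OF bounded_linear_vec_nth])
  ultimately have "(\<lambda>y. grad (\<lambda>v. grad (f v) y $ j) w) \<in> borel_measurable borel" for j
    by (intro borel_measurable_grad[where p = "\<lambda>_. w"]) simp_all
  then have "(\<lambda>y. grad (\<lambda>v. grad (f v) y $ j) w $ i) \<in> borel_measurable borel" for i j
    by (rule measurable_compose[OF _ borel_measurable_vec_nth])
  then show ?thesis
    unfolding mixed_hessian_def by (intro borel_measurable_vec_lambda)
qed

subsection \<open>Square-integrable and independent random vectors\<close>

definition square_int :: "'s measure \<Rightarrow> ('s \<Rightarrow> 'a::euclidean_space) \<Rightarrow> bool" where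
  "square_int M X \<longleftrightarrow> X \<in> borel_measurable M \<and> integrable M (\<lambda>\<omega>. (norm (X \<omega>))\<^sup>2)"

lemma square_int_measurable: "square_int M X \<Longrightarrow> X \<in> borel_measurable M"
  by (simp add: square_int_def)

lemma square_int_dominated:
  assumes "square_int M Y" "X \<in> borel_measurable M"
    and "\<And>\<omega>. norm (X \<omega>) \<le> B * norm (Y \<omega>)"
  shows "square_int M X"
  unfolding square_int_def
proof
  have "integrable M (\<lambda>\<omega>. B\<^sup>2 * (norm (Y \<omega>))\<^sup>2)"
    using assms by (simp add: square_int_def)
  then show "integrable M (\<lambda>\<omega>. (norm (X \<omega>))\<^sup>2)"
  proof (rule Bochner_Integration.integrable_bound)
    show "AE \<omega> in M. norm ((norm (X \<omega>))\<^sup>2) \<le> norm (B\<^sup>2 * (norm (Y \<omega>))\<^sup>2)"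
      using power_mono[OF assms(3), of _ 2] by (simp add: power_mult_distrib)
  qed (use assms in measurable)
qed fact

lemma square_int_scaleR: "square_int M X \<Longrightarrow> square_int M (\<lambda>\<omega>. a *\<^sub>R X \<omega>)"
  by (rule square_int_dominated[where B = "\<bar>a\<bar>"]) (auto simp: square_int_def)

lemma square_int_integrable_inner:
  assumes "square_int M X" "square_int M Y"
  shows "integrable M (\<lambda>\<omega>. inner (X \<omega>) (Y \<omega>))"
proof (rule Bochner_Integration.integrable_bound)
  show "integrable M (\<lambda>\<omega>. (norm (X \<omega>))\<^sup>2 + (norm (Y \<omega>))\<^sup>2)"
    using assms by (simp add: square_int_def)
  show "(\<lambda>\<omega>. inner (X \<omega>) (Y \<omega>)) \<in> borel_measurable M"
    using assms by (intro borel_measurable_inner) (simp_all add: square_int_def)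
  have "\<bar>inner u v\<bar> \<le> (norm u)\<^sup>2 + (norm v)\<^sup>2" for u v :: 'b
  proof -
    have "\<bar>inner u v\<bar> \<le> norm u * norm v"
      by (rule Cauchy_Schwarz_ineq2)
    also have "\<dots> \<le> 2 * norm u * norm v" by simp
    also have "\<dots> \<le> (norm u)\<^sup>2 + (norm v)\<^sup>2"
      by (rule sum_squares_bound)
    finally show ?thesis .
  qed
  then show "AE \<omega> in M. norm (inner (X \<omega>) (Y \<omega>)) \<le> norm ((norm (X \<omega>))\<^sup>2 + (norm (Y \<omega>))\<^sup>2)"
    by simp
qed

lemma (in prob_space) square_int_integrable:
  assumes "square_int M X"
  shows "integrable M X"
proof -
  have "integrable M (\<lambda>\<omega>. norm (X \<omega>))"
    by (rule square_integrable_imp_integrable)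
      (use assms in \<open>auto simp: square_int_def intro: borel_measurable_norm\<close>)
  then show ?thesis
    using assms by (simp add: square_int_def integrable_norm_iff)
qed

lemma square_int_add:
  assumes "square_int M X" "square_int M Y"
  shows "square_int M (\<lambda>\<omega>. X \<omega> + Y \<omega>)"
proof -
  have "(norm (X \<omega> + Y \<omega>))\<^sup>2 = (norm (X \<omega>))\<^sup>2 + 2 * inner (X \<omega>) (Y \<omega>) + (norm (Y \<omega>))\<^sup>2" for \<omega>
    by (simp add: power2_norm_eq_inner inner_add_left inner_add_right inner_commute)
  moreover have "(\<lambda>\<omega>. X \<omega> + Y \<omega>) \<in> borel_measurable M"
    using assms by (intro borel_measurable_add) (simp_all add: square_int_def)
  ultimately show ?thesis
    using assms square_int_integrable_inner[OF assms] by (simp add: square_int_def)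
qed

lemma square_int_sum:
  assumes "\<And>i. i \<in> I \<Longrightarrow> square_int M (X i)"
  shows "square_int M (\<lambda>\<omega>. \<Sum>i\<in>I. X i \<omega>)"
  using assms
  by (induction I rule: infinite_finite_induct) (auto simp: square_int_add, auto simp: square_int_def)

text \<open>Pythagoras for square-integrable random vectors: expanding the squared norm leaves only
  the diagonal terms.\<close>

lemma orthogonal_sum_second_moment:
  assumes "finite I" and Z: "\<And>i. i \<in> I \<Longrightarrow> square_int M (Z i)"
    and orth: "\<And>i j. i \<in> I \<Longrightarrow> j \<in> I \<Longrightarrow> i \<noteq> j \<Longrightarrow> (\<integral>\<omega>. inner (Z i \<omega>) (Z j \<omega>) \<partial>M) = 0"
  shows "(\<integral>\<omega>. (norm (\<Sum>i\<in>I. Z i \<omega>))\<^sup>2 \<partial>M) = (\<Sum>i\<in>I. \<integral>\<omega>. (norm (Z i \<omega>))\<^sup>2 \<partial>M)"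
proof -
  have "(\<integral>\<omega>. (norm (\<Sum>i\<in>I. Z i \<omega>))\<^sup>2 \<partial>M) = (\<integral>\<omega>. (\<Sum>i\<in>I. \<Sum>j\<in>I. inner (Z i \<omega>) (Z j \<omega>)) \<partial>M)"
    by (simp add: power2_norm_eq_inner inner_sum_left inner_sum_right)
      (subst sum.swap, simp)
  also have "\<dots> = (\<Sum>i\<in>I. \<Sum>j\<in>I. \<integral>\<omega>. inner (Z i \<omega>) (Z j \<omega>) \<partial>M)"
    using Z by (simp add: Bochner_Integration.integral_sum Bochner_Integration.integrable_sum
        square_int_integrable_inner)
  also have "\<dots> = (\<Sum>i\<in>I. \<Sum>j\<in>I. if j = i then \<integral>\<omega>. (norm (Z i \<omega>))\<^sup>2 \<partial>M else 0)"
    using orth by (intro sum.cong refl) (auto simp: power2_norm_eq_inner)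
  also have "\<dots> = (\<Sum>i\<in>I. \<integral>\<omega>. (norm (Z i \<omega>))\<^sup>2 \<partial>M)"
    using \<open>finite I\<close> by simp
  finally show ?thesis .
qed

section \<open>Moments of Gaussian vectors\<close>

lemma (in prob_space) normal_rv_moments:
  assumes Z: "Z \<in> borel_measurable M" and N: "normal_rv M Z \<mu>"
  shows "integrable M (\<lambda>\<omega>. (Z \<omega>)\<^sup>2)" and "expectation Z = \<mu>"
proof -
  consider s where "s > 0" "distributed M lborel Z (\<lambda>z. ennreal (normal_density \<mu> s z))"
    | "AE \<omega> in M. Z \<omega> = \<mu>"
    using N by (auto simp: normal_rv_def)
  then have "integrable M (\<lambda>\<omega>. (Z \<omega>)\<^sup>2) \<and> expectation Z = \<mu>"
  proof cases
    case (1 s)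
    have sq: "integrable M (\<lambda>\<omega>. (Z \<omega> - \<mu>)\<^sup>2)"
      using distributed_integrable[OF 1(2), of "\<lambda>z. (z - \<mu>)\<^sup>2"]
        integrable_normal_moment[OF 1(1), of \<mu> 2] by simp
    then have "integrable M (\<lambda>\<omega>. Z \<omega> - \<mu>)"
      by (rule square_integrable_imp_integrable[rotated]) (use Z in simp)
    \<comment> \<open>The moment at hand is the central one; expanding around \<mu> recovers the
      moment about 0.\<close>
    with sq have "integrable M (\<lambda>\<omega>. (Z \<omega> - \<mu>)\<^sup>2 + 2 * \<mu> * (Z \<omega> - \<mu>) + \<mu>\<^sup>2)"
      by simp
    moreover have "(Z \<omega> - \<mu>)\<^sup>2 + 2 * \<mu> * (Z \<omega> - \<mu>) + \<mu>\<^sup>2 = (Z \<omega>)\<^sup>2" for \<omega>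
      by (simp add: power2_eq_square algebra_simps)
    ultimately show ?thesis
      using normal_distributed_expectation[OF 1] by simp
  next
    case 2
    have "integrable M (\<lambda>\<omega>. (Z \<omega>)\<^sup>2) \<longleftrightarrow> integrable M (\<lambda>\<omega>. \<mu>\<^sup>2)"
      using 2 Z by (intro integrable_cong_AE) auto
    moreover have "expectation Z = expectation (\<lambda>\<omega>. \<mu>)"
      using 2 Z by (intro integral_cong_AE) auto
    ultimately show ?thesis
      by (simp add: prob_space)
  qed
  then show "integrable M (\<lambda>\<omega>. (Z \<omega>)\<^sup>2)" and "expectation Z = \<mu>" by auto
qed

text \<open>Coordinates are linear functionals, hence normal or constant. The squared norm is the
  finite sum of their squares, and the mean is determined by its coordinates.\<close>

lemma (in prob_space) gaussian_vector_moments: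
  assumes "gaussian_vector M X \<mu>"
  shows "square_int M X" and "expectation X = \<mu>"
proof -
  have X: "X \<in> borel_measurable M" and N: "normal_rv M (\<lambda>\<omega>. inner a (X \<omega>)) (inner a \<mu>)" for a
    using assms by (auto simp: gaussian_vector_def)
  note mom = normal_rv_moments[OF _ N]
  have "(norm (X \<omega>))\<^sup>2 = (\<Sum>b\<in>Basis. (inner b (X \<omega>))\<^sup>2)" for \<omega>
    unfolding power2_norm_eq_inner
    by (subst euclidean_inner) (simp add: power2_eq_square inner_commute)
  then show sq: "square_int M X"
    using mom(1) X by (simp add: square_int_def Bochner_Integration.integrable_sum)
  show "expectation X = \<mu>"
  proof (rule euclidean_eqI)
    fix b
    have "inner b (expectation X) = expectation (\<lambda>\<omega>. inner b (X \<omega>))"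
      using square_int_integrable[OF sq] by simp
    also have "\<dots> = inner b \<mu>"
      using mom(2) X by simp
    finally show "inner (expectation X) b = inner \<mu> b"
      by (simp add: inner_commute)
  qed
qed

section \<open>Independence of one source from all others\<close>

lemma Int_stable_rv_events: "Int_stable (rv_events M X)"
proof (rule Int_stableI)
  fix A B assume "A \<in> rv_events M X" "B \<in> rv_events M X"
  then obtain A' B' where "A = X -` A' \<inter> space M" "B = X -` B' \<inter> space M"
    "A' \<in> sets borel" "B' \<in> sets borel"
    by (auto simp: rv_events_def)
  then have "A \<inter> B = X -` (A' \<inter> B') \<inter> space M" "A' \<inter> B' \<in> sets borel"
    by auto
  then show "A \<inter> B \<in> rv_events M X"
    unfolding rv_events_def by blast
qed

text \<open>The index set is split into the blocks \<open>{j}\<close> and \<open>I - {j}\<close>,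
  indexed by booleans. Disjoint blocks of independent, intersection-stable families generate
  independent sigma-algebras; the one of \<open>j\<close> is then shrunk back to the family
  \<open>E j\<close>.\<close>

lemma (in prob_space) indep_set_rest:
  assumes indep: "indep_sets E I" and "j \<in> I"
    and stable: "\<And>i. i \<in> I \<Longrightarrow> Int_stable (E i)"
  shows "indep_set (E j) (sigma_sets (space M) (\<Union>i\<in>I - {j}. E i))"
proof -
  let ?J = "case_bool {j} (I - {j})"
  have "indep_sets E (\<Union>l\<in>UNIV. ?J l)"
    using indep \<open>j \<in> I\<close> by (auto simp: UNIV_bool insert_absorb)
  then have "indep_sets (\<lambda>l. sigma_sets (space M) (\<Union>i\<in>?J l. E i)) UNIV"
  proof (rule indep_sets_collect_sigma)
    show "Int_stable (E i)" if "i \<in> ?J l" for i l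
      using that stable \<open>j \<in> I\<close> by (cases l) simp_all
    show "disjoint_family_on ?J UNIV"
      by (auto simp: disjoint_family_on_def split: bool.splits)
  qed
  then show ?thesis
    unfolding indep_set_def
    by (rule indep_sets_mono_sets) (auto split: bool.splits)
qed

text \<open>In coordinates the inner product is a finite sum of products of independent real
  variables, so each expectation factors and one factor is 0. Independence also makes the products
  integrable from first moments alone. \<open>N\<close> is a sub-sigma-algebra, so that
  \<open>Q\<close> may depend on many sources at once.\<close>

lemma (in prob_space) expectation_inner_indep_zero_mean:
  fixes X Q :: "'a \<Rightarrow> 'b::euclidean_space"
  assumes indep: "indep_set (rv_events M X) (sets N)" and N: "space N = space M"
    and X: "integrable M X" and mean: "expectation X = 0"
    and Q: "Q \<in> borel_measurable N" "integrable M Q"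
  shows "expectation (\<lambda>\<omega>. inner (Q \<omega>) (X \<omega>)) = 0"
proof -
  have iv: "indep_var borel (\<lambda>\<omega>. inner (X \<omega>) e) borel (\<lambda>\<omega>. inner (Q \<omega>) e)" for e
  proof -
    have XM: "X \<in> borel_measurable M" and QM: "Q \<in> borel_measurable M"
      using X Q(2) by auto
    have "indep_set {(\<lambda>\<omega>. inner (X \<omega>) e) -` A \<inter> space M | A. A \<in> sets borel}
        {(\<lambda>\<omega>. inner (Q \<omega>) e) -` A \<inter> space M | A. A \<in> sets borel}"
      unfolding indep_set_def
    proof (rule indep_sets_mono_sets[OF indep[unfolded indep_set_def]])
      fix l :: bool
      have "(\<lambda>\<omega>. inner (X \<omega>) e) -` A \<inter> space M \<in> rv_events M X" if "A \<in> sets borel" for A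
      proof -
        have "(\<lambda>v. inner v e) -` A \<in> sets borel"
          using measurable_sets[OF _ that, of "\<lambda>v. inner v e" "borel"] by simp
        then show ?thesis
          unfolding rv_events_def by (intro CollectI exI[of _ "(\<lambda>v. inner v e) -` A"]) auto
      qed
      moreover have "(\<lambda>\<omega>. inner (Q \<omega>) e) -` A \<inter> space M \<in> sets N" if "A \<in> sets borel" for A
        using measurable_sets[OF _ that, of "\<lambda>\<omega>. inner (Q \<omega>) e" N] Q(1) N by simp
      ultimately show "(case l of True \<Rightarrow> {(\<lambda>\<omega>. inner (X \<omega>) e) -` A \<inter> space M | A. A \<in> sets borel}
          | False \<Rightarrow> {(\<lambda>\<omega>. inner (Q \<omega>) e) -` A \<inter> space M | A. A \<in> sets borel})
        \<subseteq> (case l of True \<Rightarrow> rv_events M X | False \<Rightarrow> sets N)"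
        by (auto split: bool.split)
    qed
    \<comment> \<open>\<open>indep_var\<close> speaks about generated sigma-algebras; intersection
      stability lifts independence to them.\<close>
    then have "indep_set
        (sigma_sets (space M) {(\<lambda>\<omega>. inner (X \<omega>) e) -` A \<inter> space M | A. A \<in> sets borel})
        (sigma_sets (space M) {(\<lambda>\<omega>. inner (Q \<omega>) e) -` A \<inter> space M | A. A \<in> sets borel})"
      using Int_stable_rv_events[of M "\<lambda>\<omega>. inner (X \<omega>) e"]
        Int_stable_rv_events[of M "\<lambda>\<omega>. inner (Q \<omega>) e"]
      by (intro indep_set_sigma_sets) (simp_all add: rv_events_def)
    then show ?thesis
      using XM QM by (simp add: indep_var_eq)
  qed
  have prod: "integrable M (\<lambda>\<omega>. inner (X \<omega>) e * inner (Q \<omega>) e)"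
    "expectation (\<lambda>\<omega>. inner (X \<omega>) e * inner (Q \<omega>) e) = 0" for e
    using indep_var_integrable[OF iv[of e]] indep_var_lebesgue_integral[OF iv[of e]] X Q(2) mean
    by simp_all
  have "inner (Q \<omega>) (X \<omega>) = (\<Sum>e\<in>Basis. inner (X \<omega>) e * inner (Q \<omega>) e)" for \<omega>
    by (subst euclidean_inner) (simp add: mult.commute)
  then show ?thesis
    using prod by (simp add: Bochner_Integration.integral_sum)
qed

section \<open>Expected descent of a smooth function under a noisy gradient step\<close>

lemma (in prob_space) expected_descent:
  fixes F :: "'b::euclidean_space \<Rightarrow> real"
  assumes F: "F \<in> borel_measurable borel" "\<And>v. Fmin \<le> F v"
    and smooth: "\<And>v. F v \<le> F w + inner (v - w) g + L / 2 * (norm (v - w))\<^sup>2"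
    and L: "0 \<le> L" and err: "square_int M err" "expectation err = 0"
    and V: "expectation (\<lambda>\<omega>. (norm (err \<omega>))\<^sup>2) \<le> V"
  shows "(a - L * a\<^sup>2 / 2) * (norm g)\<^sup>2 - L * a\<^sup>2 / 2 * V
    \<le> expectation (\<lambda>\<omega>. F w - F (w - a *\<^sub>R (g + err \<omega>)))"
proof -
  \<comment> \<open>\<open>q\<close> is the smoothness inequality at the new point, solved for the
    decrease; \<open>p\<close> is the same quantity sorted by powers of \<open>err\<close>. Its
    linear coefficient joins \<open>a\<close> from the gradient term with
    \<open>- L * a\<^sup>2\<close> from the cross term of the square, and this linear part has mean
    zero.\<close>
  define q where "q \<omega> = a * inner (g + err \<omega>) g - L / 2 * a\<^sup>2 * (norm (g + err \<omega>))\<^sup>2" for \<omega>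
  define p where "p \<omega> = (a - L * a\<^sup>2 / 2) * (norm g)\<^sup>2 + (a - L * a\<^sup>2) * inner g (err \<omega>)
    - L * a\<^sup>2 / 2 * (norm (err \<omega>))\<^sup>2" for \<omega>
  have qp: "q \<omega> = p \<omega>" for \<omega>
    by (simp add: q_def p_def power2_norm_eq_inner inner_add_left inner_add_right inner_commute
        algebra_simps)
  have int: "integrable M err" "integrable M (\<lambda>\<omega>. (norm (err \<omega>))\<^sup>2)"
    using square_int_integrable[OF err(1)] err(1) by (auto simp: square_int_def)
  then have p: "integrable M p"
    unfolding p_def by simp
  have lower: "p \<omega> \<le> F w - F (w - a *\<^sub>R (g + err \<omega>))" for \<omega>
    using smooth[of "w - a *\<^sub>R (g + err \<omega>)"] qp[of \<omega>]
    by (simp add: q_def power_mult_distrib)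
  have step: "(\<lambda>\<omega>. w - a *\<^sub>R (g + err \<omega>)) \<in> borel_measurable M"
    using int(1) by simp
  have meas: "(\<lambda>\<omega>. F w - F (w - a *\<^sub>R (g + err \<omega>))) \<in> borel_measurable M"
    using measurable_compose[OF step F(1)] by simp
  \<comment> \<open>The integral of a non-integrable function defaults to 0, so monotonicity needs
    this. The decrease lies between \<open>p\<close> and the constant
    \<open>F w - Fmin\<close>.\<close>
  have "integrable M (\<lambda>\<omega>. F w - F (w - a *\<^sub>R (g + err \<omega>)))"
  proof (rule Bochner_Integration.integrable_bound[OF _ meas])
    show "integrable M (\<lambda>\<omega>. \<bar>p \<omega>\<bar> + \<bar>F w - Fmin\<bar>)"
      using p by simp
    have "\<bar>F w - F (w - a *\<^sub>R (g + err \<omega>))\<bar> \<le> \<bar>p \<omega>\<bar> + \<bar>F w - Fmin\<bar>" for \<omega>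
      using lower[of \<omega>] F(2)[of "w - a *\<^sub>R (g + err \<omega>)"] by linarith
    then show "AE \<omega> in M. norm (F w - F (w - a *\<^sub>R (g + err \<omega>))) \<le> norm (\<bar>p \<omega>\<bar> + \<bar>F w - Fmin\<bar>)"
      by simp
  qed
  then have "expectation p \<le> expectation (\<lambda>\<omega>. F w - F (w - a *\<^sub>R (g + err \<omega>)))"
    using p lower by (intro integral_mono)
  moreover have "expectation p = (a - L * a\<^sup>2 / 2) * (norm g)\<^sup>2
      - L * a\<^sup>2 / 2 * expectation (\<lambda>\<omega>. (norm (err \<omega>))\<^sup>2)"
    using int err(2) unfolding p_def by (simp add: prob_space)
  moreover have "L * a\<^sup>2 / 2 * expectation (\<lambda>\<omega>. (norm (err \<omega>))\<^sup>2) \<le> L * a\<^sup>2 / 2 * V"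
    using V L by (intro mult_left_mono) auto
  ultimately show ?thesis by linarith
qed

subsection \<open>The gradient error of one round\<close>

lemma finite_sources: "finite (sources K b)"
  by (auto simp: sources_def)

text \<open>Passes from the flat index set, convenient for orthogonality, to the sums over devices
  and samples in the recovered gradient and in the bound. Distinct indices give distinct sources, so
  the unions are disjoint.\<close>

lemma sum_sources:
  fixes \<phi> :: "source \<Rightarrow> 'a::comm_monoid_add"
  shows "(\<Sum>j\<in>sources K b. \<phi> j) =
    (\<Sum>k=1..K. \<Sum>i=1..b k. \<phi> (Sample k i) + \<phi> (Clutter k i) + \<phi> (Sensing_Noise k i))
      + \<phi> Channel_Noise"
proof -
  let ?S = "\<lambda>k i. {Sample k i, Clutter k i, Sensing_Noise k i}"
  have "(\<Sum>j\<in>sources K b. \<phi> j) = (\<Sum>j\<in>(\<Union>k\<in>{1..K}. \<Union>i\<in>{1..b k}. ?S k i). \<phi> j) + \<phi> Channel_Noise"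
    unfolding sources_def by (subst sum.union_disjoint) auto
  also have "(\<Sum>j\<in>(\<Union>k\<in>{1..K}. \<Union>i\<in>{1..b k}. ?S k i). \<phi> j)
      = (\<Sum>k=1..K. \<Sum>j\<in>(\<Union>i\<in>{1..b k}. ?S k i). \<phi> j)"
    by (rule sum.UNION_disjoint) auto
  also have "\<dots> = (\<Sum>k=1..K. \<Sum>i=1..b k. \<Sum>j\<in>?S k i. \<phi> j)"
    by (intro sum.cong refl sum.UNION_disjoint) auto
  finally show ?thesis
    by (simp add: add.assoc)
qed

text \<open>With the model held fixed, sample gradient and Hessian become Borel functions \<gamma>
  and \<open>h\<close> of the data alone. The scales \<open>s\<close>, \<open>r k\<close> and
  \<open>e\<close> stand for the averaging factor, the inverse root of the sensing power and the
  inverse root of the receive power.\<close>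

locale noisy_batch = prob_space M for M :: "'s measure" +
  fixes K :: nat and b :: "nat \<Rightarrow> nat"
    and \<gamma> :: "real ^ 'd \<Rightarrow> real ^ 'p" and h :: "real ^ 'd \<Rightarrow> real ^ 'd ^ 'p" and g :: "real ^ 'p"
    and x c n :: "nat \<Rightarrow> nat \<Rightarrow> 's \<Rightarrow> real ^ 'd" and u :: "'s \<Rightarrow> real ^ 'p"
    and A s e :: real and r :: "nat \<Rightarrow> real"
  assumes gradient_measurable: "\<gamma> \<in> borel_measurable borel"
    and hessian_measurable: "h \<in> borel_measurable borel"
    and hessian_bound: "norm (h y) \<le> A"
    and sample: "Sample k i \<in> sources K b \<Longrightarrow> x k i \<in> borel_measurable M"
    and clutter: "Clutter k i \<in> sources K b \<Longrightarrow> square_int M (c k i)"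
      "Clutter k i \<in> sources K b \<Longrightarrow> expectation (c k i) = 0"
    and sensing_noise: "Sensing_Noise k i \<in> sources K b \<Longrightarrow> square_int M (n k i)"
      "Sensing_Noise k i \<in> sources K b \<Longrightarrow> expectation (n k i) = 0"
    and channel_noise: "square_int M u" "expectation u = 0"
    and gradient: "Sample k i \<in> sources K b \<Longrightarrow> square_int M (\<lambda>\<omega>. \<gamma> (x k i \<omega>) - g)"
      "Sample k i \<in> sources K b \<Longrightarrow> expectation (\<lambda>\<omega>. \<gamma> (x k i \<omega>) - g) = 0"
    and independent: "independent_inputs M K b x c n u"
begin

definition events_of :: "source \<Rightarrow> 's set set" where
  "events_of j = (case j of
      Sample k i \<Rightarrow> rv_events M (x k i)
    | Clutter k i \<Rightarrow> rv_events M (c k i)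
    | Sensing_Noise k i \<Rightarrow> rv_events M (n k i)
    | Channel_Noise \<Rightarrow> rv_events M u)"

text \<open>Everything determined without source \<open>j\<close>. Packaging this sigma-algebra as a
  measure turns "depends only on the other sources" into a measurability statement.\<close>

definition others :: "source \<Rightarrow> 's measure" where
  "others j = sigma (space M) (\<Union>l\<in>sources K b - {j}. events_of l)"

text \<open>A clutter or sensing noise term involves two sources but is filed under its noise, the
  one in which it is linear.\<close>

definition err :: "source \<Rightarrow> 's \<Rightarrow> real ^ 'p" where
  "err j \<omega> = (case j of
      Sample k i \<Rightarrow> s *\<^sub>R (\<gamma> (x k i \<omega>) - g)
    | Clutter k i \<Rightarrow> s *\<^sub>R (h (x k i \<omega>) *v c k i \<omega>)
    | Sensing_Noise k i \<Rightarrow> (s * r k) *\<^sub>R (h (x k i \<omega>) *v n k i \<omega>)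
    | Channel_Noise \<Rightarrow> e *\<^sub>R u \<omega>)"

lemma events_of_subset: "events_of l \<subseteq> Pow (space M)"
  by (auto simp: events_of_def rv_events_def split: source.splits)

lemma space_others: "space (others j) = space M"
  and sets_others: "sets (others j) = sigma_sets (space M) (\<Union>l\<in>sources K b - {j}. events_of l)"
  using events_of_subset by (auto simp: others_def intro!: space_measure_of sets_measure_of)

lemma indep_set_others:
  assumes "j \<in> sources K b"
  shows "indep_set (events_of j) (sets (others j))"
  unfolding sets_others
proof (rule indep_set_rest)
  show "indep_sets events_of (sources K b)"
    using independent unfolding independent_inputs_def events_of_def .
qed (use assms in \<open>auto simp: events_of_def Int_stable_rv_events split: source.splits\<close>)

lemma measurable_others:
  fixes X :: "'s \<Rightarrow> 'b::topological_space"
  assumes "l \<in> sources K b" "l \<noteq> j" "events_of l = rv_events M X"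
  shows "X \<in> borel_measurable (others j)"
proof (rule measurableI)
  fix B :: "'b set" assume "B \<in> sets borel"
  then have "X -` B \<inter> space M \<in> events_of l"
    using assms(3) by (auto simp: rv_events_def)
  then show "X -` B \<inter> space (others j) \<in> sets (others j)"
    using assms(1,2) unfolding space_others sets_others by (blast intro: sigma_sets.Basic)
qed simp

lemma sample_source:
  assumes "l \<in> {Clutter k i, Sensing_Noise k i}" "l \<in> sources K b"
  shows "Sample k i \<in> sources K b"
  using assms by (auto simp: sources_def)

lemma hessian_others:
  assumes "Sample k i \<in> sources K b" "j \<noteq> Sample k i"
  shows "(\<lambda>\<omega>. h (x k i \<omega>)) \<in> borel_measurable (others j)"
  using assms
  by (intro measurable_compose[OF measurable_others hessian_measurable, of "Sample k i"])
    (auto simp: events_of_def)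

text \<open>A sampling error involves nothing but its own sample. Any other term may need a sample
  for its Hessian, and \<open>others j\<close> contains all samples as soon as \<open>j\<close> is
  not one. The excluded pairs, with \<open>j\<close> a sample and \<open>l\<close> not, are reached
  by exchanging the two.\<close>

lemma err_others:
  assumes l: "l \<in> sources K b" "l \<noteq> j"
    and j: "(\<exists>k i. l = Sample k i) \<or> \<not> (\<exists>k i. j = Sample k i)"
  shows "err l \<in> borel_measurable (others j)"
proof (cases l)
  case (Sample k i)
  have "x k i \<in> borel_measurable (others j)"
    using l Sample by (intro measurable_others[of l]) (auto simp: events_of_def)
  then have "(\<lambda>\<omega>. \<gamma> (x k i \<omega>)) \<in> borel_measurable (others j)"
    by (rule measurable_compose[OF _ gradient_measurable])
  then show ?thesis
    using Sample by (simp add: err_def[abs_def])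
next
  case (Clutter k i)
  have "c k i \<in> borel_measurable (others j)"
    using l Clutter by (intro measurable_others[of l]) (auto simp: events_of_def)
  then have "(\<lambda>\<omega>. h (x k i \<omega>) *v c k i \<omega>) \<in> borel_measurable (others j)"
    by (rule borel_measurable_matrix_vector_mult[OF hessian_others, rotated 2])
      (use l j Clutter sample_source[of l] in auto)
  then show ?thesis
    using Clutter by (simp add: err_def[abs_def])
next
  case (Sensing_Noise k i)
  have "n k i \<in> borel_measurable (others j)"
    using l Sensing_Noise by (intro measurable_others[of l]) (auto simp: events_of_def)
  then have "(\<lambda>\<omega>. h (x k i \<omega>) *v n k i \<omega>) \<in> borel_measurable (others j)"
    by (rule borel_measurable_matrix_vector_mult[OF hessian_others, rotated 2])
      (use l j Sensing_Noise sample_source[of l] in auto)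
  then show ?thesis
    using Sensing_Noise by (simp add: err_def[abs_def])
next
  case Channel_Noise
  have "u \<in> borel_measurable (others j)"
    using l Channel_Noise by (intro measurable_others[of l]) (auto simp: events_of_def)
  then show ?thesis
    using Channel_Noise by (simp add: err_def[abs_def])
qed

lemma hessian_mult:
  assumes "Sample k i \<in> sources K b" "square_int M y"
  shows "square_int M (\<lambda>\<omega>. h (x k i \<omega>) *v y \<omega>)"
proof (rule square_int_dominated[OF assms(2)])
  show "(\<lambda>\<omega>. h (x k i \<omega>) *v y \<omega>) \<in> borel_measurable M"
    by (intro borel_measurable_matrix_vector_mult measurable_compose[OF sample hessian_measurable]
        square_int_measurable assms)
  show "norm (h (x k i \<omega>) *v y \<omega>) \<le> A * norm (y \<omega>)" for \<omega>
    by (rule order_trans[OF norm_matrix_vector_mult_le]) (intro mult_right_mono hessian_bound norm_ge_zero)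
qed

lemma hessian_mult_second_moment:
  assumes "Sample k i \<in> sources K b" "square_int M y"
  shows "expectation (\<lambda>\<omega>. (norm (h (x k i \<omega>) *v y \<omega>))\<^sup>2) \<le> A\<^sup>2 * expectation (\<lambda>\<omega>. (norm (y \<omega>))\<^sup>2)"
proof -
  have "expectation (\<lambda>\<omega>. (norm (h (x k i \<omega>) *v y \<omega>))\<^sup>2) \<le> expectation (\<lambda>\<omega>. A\<^sup>2 * (norm (y \<omega>))\<^sup>2)"
  proof (rule integral_mono)
    fix \<omega>
    have "norm (h (x k i \<omega>) *v y \<omega>) \<le> A * norm (y \<omega>)"
      by (rule order_trans[OF norm_matrix_vector_mult_le]) (intro mult_right_mono hessian_bound norm_ge_zero)
    from power_mono[OF this, of 2]
    show "(norm (h (x k i \<omega>) *v y \<omega>))\<^sup>2 \<le> A\<^sup>2 * (norm (y \<omega>))\<^sup>2"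
      by (simp add: power_mult_distrib)
  qed (use hessian_mult[OF assms] assms(2) in \<open>auto simp: square_int_def\<close>)
  then show ?thesis by simp
qed

lemma square_int_err:
  assumes "j \<in> sources K b"
  shows "square_int M (err j)"
  using assms sample_source[of j]
  by (cases j)
    (auto simp: err_def[abs_def] intro!: square_int_scaleR hessian_mult gradient clutter
      sensing_noise channel_noise)

text \<open>Once its own source is integrated out, each error term vanishes against everything that the
  remaining sources determine; for clutter and sensing noise the sample is one of these.\<close>

lemma err_orthogonal_others:
  assumes j: "j \<in> sources K b" and Q: "Q \<in> borel_measurable (others j)" "square_int M Q"
  shows "expectation (\<lambda>\<omega>. inner (Q \<omega>) (err j \<omega>)) = 0"
proof -
  note ortho = expectation_inner_indep_zero_mean[OF _ space_others square_int_integrable _ _ square_int_integrable]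
  have noise: "expectation (\<lambda>\<omega>. inner (Q \<omega>) (h (x k i \<omega>) *v y \<omega>)) = 0"
    if S: "Sample k i \<in> sources K b" "j \<noteq> Sample k i" and ev: "events_of j = rv_events M y"
      and y: "square_int M y" "expectation y = 0" for k i y
  proof -
    \<comment> \<open>The Hessian moves to the other side as its adjoint; \<open>Q v* h\<close> is
      still determined without \<open>j\<close>, because the sample is a different source.\<close>
    have "expectation (\<lambda>\<omega>. inner (Q \<omega> v* h (x k i \<omega>)) (y \<omega>)) = 0"
    proof (rule ortho[OF _ y])
      show "indep_set (rv_events M y) (sets (others j))"
        using indep_set_others[OF j] ev by simp
      show "(\<lambda>\<omega>. Q \<omega> v* h (x k i \<omega>)) \<in> borel_measurable (others j)"
        using hessian_others[OF S] Q(1) by (rule borel_measurable_vector_matrix_mult)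
      show "square_int M (\<lambda>\<omega>. Q \<omega> v* h (x k i \<omega>))"
      proof (rule square_int_dominated[OF Q(2)])
        show "(\<lambda>\<omega>. Q \<omega> v* h (x k i \<omega>)) \<in> borel_measurable M"
          by (intro borel_measurable_vector_matrix_mult measurable_compose[OF sample hessian_measurable]
              square_int_measurable S Q)
        show "norm (Q \<omega> v* h (x k i \<omega>)) \<le> A * norm (Q \<omega>)" for \<omega>
          by (rule order_trans[OF norm_vector_matrix_mult_le])
            (intro mult_right_mono hessian_bound norm_ge_zero)
      qed
    qed
    then show ?thesis by (simp add: dot_lmul_matrix)
  qed
  show ?thesis
  proof (cases j)
    case (Sample k i)
    \<comment> \<open>Since \<gamma> is Borel, events of the centred gradient are events of the
      sample and inherit its independence.\<close>
    have "rv_events M (\<lambda>\<omega>. \<gamma> (x k i \<omega>) - g) \<subseteq> rv_events M (x k i)"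
    proof
      fix E assume "E \<in> rv_events M (\<lambda>\<omega>. \<gamma> (x k i \<omega>) - g)"
      then obtain B where B: "B \<in> sets borel" "E = (\<lambda>\<omega>. \<gamma> (x k i \<omega>) - g) -` B \<inter> space M"
        by (auto simp: rv_events_def)
      have "(\<lambda>y. \<gamma> y - g) \<in> borel_measurable borel"
        using gradient_measurable by simp
      from measurable_sets[OF this B(1)] have "(\<lambda>y. \<gamma> y - g) -` B \<in> sets borel"
        by simp
      then show "E \<in> rv_events M (x k i)"
        unfolding rv_events_def by (intro CollectI exI[of _ "(\<lambda>y. \<gamma> y - g) -` B"]) (auto simp: B(2))
    qed
    then have "indep_set (rv_events M (\<lambda>\<omega>. \<gamma> (x k i \<omega>) - g)) (sets (others j))"
      using indep_set_others[OF j] Sample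
      by (auto simp: indep_sets2_eq events_of_def)
    then have "expectation (\<lambda>\<omega>. inner (Q \<omega>) (\<gamma> (x k i \<omega>) - g)) = 0"
      by (rule ortho) (use gradient[of k i] j Q Sample in auto)
    then show ?thesis
      using Sample by (simp add: err_def[abs_def])
  next
    case (Clutter k i)
    then show ?thesis
      using noise[of k i "c k i"] clutter[of k i] j sample_source[of j]
      by (simp add: err_def events_of_def)
  next
    case (Sensing_Noise k i)
    then show ?thesis
      using noise[of k i "n k i"] sensing_noise[of k i] j sample_source[of j]
      by (simp add: err_def events_of_def)
  next
    case Channel_Noise
    then have "indep_set (rv_events M u) (sets (others j))"
      using indep_set_others[OF j] by (simp add: events_of_def)
    then have "expectation (\<lambda>\<omega>. inner (Q \<omega>) (u \<omega>)) = 0"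
      using channel_noise Q by (rule ortho)
    then show ?thesis
      using Channel_Noise by (simp add: err_def[abs_def])
  qed
qed

text \<open>Constants are determined by any set of sources, so \<open>err j\<close> is orthogonal to
  every constant vector, in particular to its own mean.\<close>

lemma expectation_err:
  assumes "j \<in> sources K b"
  shows "expectation (err j) = 0"
proof -
  have "inner a (expectation (err j)) = 0" for a
    using err_orthogonal_others[OF assms, of "\<lambda>_. a"] square_int_integrable[OF square_int_err[OF assms]]
    by (simp add: square_int_def)
  from this[of "expectation (err j)"] show ?thesis by simp
qed

lemma err_orthogonal:
  assumes "i \<in> sources K b" "j \<in> sources K b" "i \<noteq> j"
  shows "expectation (\<lambda>\<omega>. inner (err i \<omega>) (err j \<omega>)) = 0"
proof (cases "(\<exists>k m. i = Sample k m) \<or> \<not> (\<exists>k m. j = Sample k m)")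
  case True
  then show ?thesis
    using assms by (intro err_orthogonal_others err_others square_int_err)
next
  case False
  \<comment> \<open>Here \<open>j\<close> is a sample and \<open>i\<close> is not, so the noise in
    \<open>i\<close> is the one to integrate out.\<close>
  then have "expectation (\<lambda>\<omega>. inner (err j \<omega>) (err i \<omega>)) = 0"
    using assms by (intro err_orthogonal_others err_others square_int_err) auto
  then show ?thesis
    by (simp add: inner_commute)
qed

lemma sum_err_moments:
  shows "square_int M (\<lambda>\<omega>. \<Sum>j\<in>sources K b. err j \<omega>)"
    and "expectation (\<lambda>\<omega>. \<Sum>j\<in>sources K b. err j \<omega>) = 0"
    and "expectation (\<lambda>\<omega>. (norm (\<Sum>j\<in>sources K b. err j \<omega>))\<^sup>2)
      = (\<Sum>j\<in>sources K b. expectation (\<lambda>\<omega>. (norm (err j \<omega>))\<^sup>2))"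
proof -
  show "square_int M (\<lambda>\<omega>. \<Sum>j\<in>sources K b. err j \<omega>)"
    by (intro square_int_sum square_int_err)
  show "expectation (\<lambda>\<omega>. \<Sum>j\<in>sources K b. err j \<omega>) = 0"
    by (simp add: Bochner_Integration.integral_sum square_int_integrable square_int_err expectation_err)
  show "expectation (\<lambda>\<omega>. (norm (\<Sum>j\<in>sources K b. err j \<omega>))\<^sup>2)
      = (\<Sum>j\<in>sources K b. expectation (\<lambda>\<omega>. (norm (err j \<omega>))\<^sup>2))"
    by (intro orthogonal_sum_second_moment finite_sources square_int_err err_orthogonal)
qed

text \<open>Orthogonality reduces the claim to single terms. The three terms of a sample share the
  factor \<open>s\<^sup>2\<close>, and their bound does not depend on \<open>i\<close>, so device
  \<open>k\<close> contributes it \<open>b k\<close> times.\<close>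

lemma sum_err_second_moment_le:
  assumes "\<And>k i. Sample k i \<in> sources K b \<Longrightarrow> expectation (\<lambda>\<omega>. (norm (\<gamma> (x k i \<omega>) - g))\<^sup>2) \<le> vg"
    and "\<And>k i. Clutter k i \<in> sources K b \<Longrightarrow> expectation (\<lambda>\<omega>. (norm (c k i \<omega>))\<^sup>2) \<le> vc k"
    and "\<And>k i. Sensing_Noise k i \<in> sources K b \<Longrightarrow> expectation (\<lambda>\<omega>. (norm (n k i \<omega>))\<^sup>2) \<le> vn"
    and "expectation (\<lambda>\<omega>. (norm (u \<omega>))\<^sup>2) \<le> vu"
  shows "expectation (\<lambda>\<omega>. (norm (\<Sum>j\<in>sources K b. err j \<omega>))\<^sup>2)
    \<le> e\<^sup>2 * vu + (\<Sum>k=1..K. real (b k) * s\<^sup>2 * (vg + A\<^sup>2 * (vc k + (r k)\<^sup>2 * vn)))"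
proof -
  let ?e2 = "\<lambda>j. expectation (\<lambda>\<omega>. (norm (err j \<omega>))\<^sup>2)"
  have batch: "?e2 (Sample k i) + ?e2 (Clutter k i) + ?e2 (Sensing_Noise k i)
      \<le> s\<^sup>2 * (vg + A\<^sup>2 * (vc k + (r k)\<^sup>2 * vn))" if "k \<in> {1..K}" "i \<in> {1..b k}" for k i
  proof -
    have src: "Sample k i \<in> sources K b" "Clutter k i \<in> sources K b" "Sensing_Noise k i \<in> sources K b"
      using that by (auto simp: sources_def)
    have "?e2 (Sample k i) \<le> s\<^sup>2 * vg"
      using assms(1)[OF src(1)] by (simp add: err_def power_mult_distrib mult_left_mono)
    moreover have "?e2 (Clutter k i) \<le> s\<^sup>2 * (A\<^sup>2 * vc k)"
    proof -
      have "expectation (\<lambda>\<omega>. (norm (h (x k i \<omega>) *v c k i \<omega>))\<^sup>2) \<le> A\<^sup>2 * vc k"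
        using hessian_mult_second_moment[OF src(1) clutter(1)[OF src(2)]]
          mult_left_mono[OF assms(2)[OF src(2)], of "A\<^sup>2"] by simp
      then show ?thesis
        by (simp add: err_def power_mult_distrib mult_left_mono)
    qed
    moreover have "?e2 (Sensing_Noise k i) \<le> (s * r k)\<^sup>2 * (A\<^sup>2 * vn)"
    proof -
      have "expectation (\<lambda>\<omega>. (norm (h (x k i \<omega>) *v n k i \<omega>))\<^sup>2) \<le> A\<^sup>2 * vn"
        using hessian_mult_second_moment[OF src(1) sensing_noise(1)[OF src(3)]]
          mult_left_mono[OF assms(3)[OF src(3)], of "A\<^sup>2"] by simp
      then have "(s * r k)\<^sup>2 * expectation (\<lambda>\<omega>. (norm (h (x k i \<omega>) *v n k i \<omega>))\<^sup>2) \<le> (s * r k)\<^sup>2 * (A\<^sup>2 * vn)"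
        by (rule mult_left_mono) simp
      moreover have "(norm (err (Sensing_Noise k i) \<omega>))\<^sup>2
          = (s * r k)\<^sup>2 * (norm (h (x k i \<omega>) *v n k i \<omega>))\<^sup>2" for \<omega>
        by (simp add: err_def power_mult_distrib)
      ultimately show ?thesis by simp
    qed
    ultimately show ?thesis
      by (simp add: power_mult_distrib algebra_simps)
  qed
  have "expectation (\<lambda>\<omega>. (norm (\<Sum>j\<in>sources K b. err j \<omega>))\<^sup>2)
      = (\<Sum>k=1..K. \<Sum>i=1..b k. ?e2 (Sample k i) + ?e2 (Clutter k i) + ?e2 (Sensing_Noise k i))
        + ?e2 Channel_Noise"
    unfolding sum_err_moments(3) by (rule sum_sources)
  also have "\<dots> \<le> (\<Sum>k=1..K. \<Sum>i=1..b k. s\<^sup>2 * (vg + A\<^sup>2 * (vc k + (r k)\<^sup>2 * vn))) + e\<^sup>2 * vu"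
    using assms(4)
    by (intro add_mono sum_mono batch) (auto simp: err_def power_mult_distrib mult_left_mono)
  finally show ?thesis
    by (simp add: mult.assoc)
qed

end

section \<open>The loss degradation of one round\<close>

theorem lemma2:
  fixes M :: "'s measure"
    and K T t :: nat
    and b :: "nat \<Rightarrow> nat \<Rightarrow> nat"
    and P :: "nat \<Rightarrow> nat \<Rightarrow> real"
    and \<eta> \<alpha> :: "nat \<Rightarrow> real"
    and A L \<sigma> Fstar \<delta>\<^sub>s \<delta>\<^sub>u :: real
    and \<delta>\<^sub>c :: "nat \<Rightarrow> real"
    and f :: "real ^ 'p \<Rightarrow> real ^ 'd \<Rightarrow> real"
    and F :: "real ^ 'p \<Rightarrow> real"
    and w\<^sub>t :: "real ^ 'p"
    and w :: "nat \<Rightarrow> 's \<Rightarrow> real ^ 'p"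
    and w\<^sub>l :: "nat \<Rightarrow> nat \<Rightarrow> 's \<Rightarrow> real ^ 'p"
    and x c n\<^sub>s :: "nat \<Rightarrow> nat \<Rightarrow> nat \<Rightarrow> 's \<Rightarrow> real ^ 'd"
    and n\<^sub>u :: "nat \<Rightarrow> 's \<Rightarrow> real ^ 'p"
  assumes prob: "prob_space M"
    and rounds: "T > 0"
    and batch: "total_batch K (b t) > 0"
    and sensing_power: "\<And>k. k \<in> {1..K} \<Longrightarrow> P t k > 0"
    and receive_power: "\<eta> t > 0"
    \<comment> \<open>regularity of the sample loss and of the loss, needed for the derivatives to exist\<close>
    and sample_loss_diff_w: "\<And>v y. (\<lambda>u. f u y) differentiable (at v)"
    and sample_loss_diff_x: "\<And>v y. f v differentiable (at y)"
    and sample_loss_diff_xw: "\<And>v y. (\<lambda>u. grad (f u) y) differentiable (at v)"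
    and loss_diff: "\<And>v. F differentiable (at v)"
    \<comment> \<open>\<open>M\<close> is the law of round \<open>t\<close> given the global model at its start, which is broadcast\<close>
    and current_model: "\<And>\<omega>. \<omega> \<in> space M \<Longrightarrow> w t \<omega> = w\<^sub>t"
    and broadcast: "\<And>k \<omega>. k \<in> {1..K} \<Longrightarrow> \<omega> \<in> space M \<Longrightarrow> w\<^sub>l t k \<omega> = w t \<omega>"
    \<comment> \<open>samples, clutter, sensing noise and channel noise\<close>
    and sample_meas:
      "\<And>k i. k \<in> {1..K} \<Longrightarrow> i \<in> {1..b t k} \<Longrightarrow> x t k i \<in> borel_measurable M"
    and clutter_gaussian:
      "\<And>k i. k \<in> {1..K} \<Longrightarrow> i \<in> {1..b t k} \<Longrightarrow> gaussian_vector M (c t k i) 0"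
    and clutter_power:
      "\<And>k i. k \<in> {1..K} \<Longrightarrow> i \<in> {1..b t k} \<Longrightarrow>
         (\<integral>\<omega>. (norm (c t k i \<omega>))\<^sup>2 \<partial>M) = (\<delta>\<^sub>c k)\<^sup>2"
    and sensing_noise_gaussian:
      "\<And>k i. k \<in> {1..K} \<Longrightarrow> i \<in> {1..b t k} \<Longrightarrow> gaussian_vector M (n\<^sub>s t k i) 0"
    and sensing_noise_power:
      "\<And>k i. k \<in> {1..K} \<Longrightarrow> i \<in> {1..b t k} \<Longrightarrow>
         (\<integral>\<omega>. (norm (n\<^sub>s t k i \<omega>))\<^sup>2 \<partial>M) = \<delta>\<^sub>s\<^sup>2"
    and channel_noise_gaussian: "gaussian_vector M (n\<^sub>u t) 0"
    and channel_noise_white: "white M (n\<^sub>u t)"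
    and channel_noise_power: "(\<integral>\<omega>. (norm (n\<^sub>u t \<omega>))\<^sup>2 \<partial>M) = \<delta>\<^sub>u\<^sup>2"
    and independent: "independent_inputs M K (b t) (x t) (c t) (n\<^sub>s t) (n\<^sub>u t)"
    and hessian_bound: "\<And>v y. norm (mixed_hessian f v y) \<le> A"
    and unbiased:
      "\<And>k i. k \<in> {1..K} \<Longrightarrow> i \<in> {1..b t k} \<Longrightarrow>
         (\<integral>\<omega>. grad (\<lambda>v. f v (x t k i \<omega>)) (w\<^sub>l t k \<omega>) \<partial>M) = grad F w\<^sub>t"
    and square_integrable:
      "\<And>k i. k \<in> {1..K} \<Longrightarrow> i \<in> {1..b t k} \<Longrightarrow>
         integrable M (\<lambda>\<omega>. (norm (grad (\<lambda>v. f v (x t k i \<omega>)) (w\<^sub>l t k \<omega>) - grad F w\<^sub>t))\<^sup>2)"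
    and variance:
      "\<And>k i. k \<in> {1..K} \<Longrightarrow> i \<in> {1..b t k} \<Longrightarrow>
         (\<integral>\<omega>. (norm (grad (\<lambda>v. f v (x t k i \<omega>)) (w\<^sub>l t k \<omega>) - grad F w\<^sub>t))\<^sup>2 \<partial>M) \<le> \<sigma>\<^sup>2"
    and bounded_below: "\<And>v. F v \<ge> Fstar"
    and L_pos: "L > 0"
    and smooth:
      "\<And>v u. F v \<le> F u + inner (v - u) (grad F u) + L / 2 * (norm (v - u))\<^sup>2"
    \<comment> \<open>model update\<close>
    and learning_rate: "\<alpha> t = 1 / (sqrt (real T) * L)"
    and update:
      "\<And>\<omega>. \<omega> \<in> space M \<Longrightarrow>
         w (Suc t) \<omega> = w t \<omega> - \<alpha> t *\<^sub>R
           recovered_gradient K (b t) (P t) (\<eta> t) f (\<lambda>k. w\<^sub>l t k \<omega>)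
             (\<lambda>k i. x t k i \<omega>) (\<lambda>k i. c t k i \<omega>) (\<lambda>k i. n\<^sub>s t k i \<omega>) (n\<^sub>u t \<omega>)"
  shows "(\<integral>\<omega>. F (w t \<omega>) - F (w (Suc t) \<omega>) \<partial>M) \<ge>
      (1 / (sqrt (real T) * L) - 1 / (2 * real T * L)) * (norm (grad F w\<^sub>t))\<^sup>2
      - 1 / (2 * real T * L) *
        (\<delta>\<^sub>u\<^sup>2 / \<eta> t +
         (\<Sum>k=1..K. real (b t k) / (real (total_batch K (b t)))\<^sup>2 *
            (\<sigma>\<^sup>2 + A\<^sup>2 * ((\<delta>\<^sub>c k)\<^sup>2 + \<delta>\<^sub>s\<^sup>2 / P t k))))"
proof -
  interpret prob_space M by (rule prob)
  define B where "B = real (total_batch K (b t))"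
  define g where "g = grad F w\<^sub>t"
  define \<gamma> where "\<gamma> y = grad (\<lambda>v. f v y) w\<^sub>t" for y
  define h where "h = mixed_hessian f w\<^sub>t"
  have B: "B > 0" using batch by (simp add: B_def)
  have local_model: "w\<^sub>l t k \<omega> = w\<^sub>t" if "k \<in> {1..K}" "\<omega> \<in> space M" for k \<omega>
    using broadcast[OF that] current_model[OF that(2)] by simp
  have \<gamma>_borel: "\<gamma> \<in> borel_measurable borel"
    unfolding \<gamma>_def using borel_measurable_differentiable[OF sample_loss_diff_x]
    by (intro borel_measurable_grad[where p = "\<lambda>_. w\<^sub>t"] sample_loss_diff_w)
  have h_borel: "h \<in> borel_measurable borel"
    unfolding h_def by (rule borel_measurable_mixed_hessian[OF sample_loss_diff_x sample_loss_diff_xw])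
  have \<gamma>_meas: "(\<lambda>\<omega>. \<gamma> (x t k i \<omega>)) \<in> borel_measurable M" if "k \<in> {1..K}" "i \<in> {1..b t k}" for k i
    by (rule measurable_compose[OF sample_meas[OF that] \<gamma>_borel])
  have \<gamma>_sq: "square_int M (\<lambda>\<omega>. \<gamma> (x t k i \<omega>) - g)"
    and \<gamma>_var: "expectation (\<lambda>\<omega>. (norm (\<gamma> (x t k i \<omega>) - g))\<^sup>2) \<le> \<sigma>\<^sup>2"
    and \<gamma>_mean: "expectation (\<lambda>\<omega>. \<gamma> (x t k i \<omega>) - g) = 0"
    if ki: "k \<in> {1..K}" "i \<in> {1..b t k}" for k i
  proof -
    \<comment> \<open>The local model equals \<open>w\<^sub>t\<close> only on the space of
      \<open>M\<close>, so it is replaced by congruence under the integral.\<close>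
    have "integrable M (\<lambda>\<omega>. (norm (\<gamma> (x t k i \<omega>) - g))\<^sup>2) \<longleftrightarrow>
        integrable M (\<lambda>\<omega>. (norm (grad (\<lambda>v. f v (x t k i \<omega>)) (w\<^sub>l t k \<omega>) - grad F w\<^sub>t))\<^sup>2)"
      by (rule Bochner_Integration.integrable_cong) (simp_all add: local_model[OF ki(1)] \<gamma>_def g_def)
    then show sq: "square_int M (\<lambda>\<omega>. \<gamma> (x t k i \<omega>) - g)"
      using square_integrable[OF ki] \<gamma>_meas[OF ki] by (simp add: square_int_def)
    have "expectation (\<lambda>\<omega>. (norm (\<gamma> (x t k i \<omega>) - g))\<^sup>2) =
        expectation (\<lambda>\<omega>. (norm (grad (\<lambda>v. f v (x t k i \<omega>)) (w\<^sub>l t k \<omega>) - grad F w\<^sub>t))\<^sup>2)"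
      by (rule Bochner_Integration.integral_cong) (simp_all add: local_model[OF ki(1)] \<gamma>_def g_def)
    then show "expectation (\<lambda>\<omega>. (norm (\<gamma> (x t k i \<omega>) - g))\<^sup>2) \<le> \<sigma>\<^sup>2"
      using variance[OF ki] by simp
    have "expectation (\<lambda>\<omega>. \<gamma> (x t k i \<omega>)) =
        expectation (\<lambda>\<omega>. grad (\<lambda>v. f v (x t k i \<omega>)) (w\<^sub>l t k \<omega>))"
      by (rule Bochner_Integration.integral_cong) (simp_all add: local_model[OF ki(1)] \<gamma>_def)
    then have "expectation (\<lambda>\<omega>. \<gamma> (x t k i \<omega>)) = g"
      using unbiased[OF ki] by (simp add: g_def)
    \<comment> \<open>Splitting the mean needs integrability of the uncentred gradient, which is the
      square-integrable centred one plus a constant.\<close>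
    moreover have "integrable M (\<lambda>\<omega>. \<gamma> (x t k i \<omega>))"
      using Bochner_Integration.integrable_add[OF square_int_integrable[OF sq] integrable_const[of g]]
      by simp
    ultimately show "expectation (\<lambda>\<omega>. \<gamma> (x t k i \<omega>) - g) = 0"
      by (simp add: prob_space)
  qed
  have source_indices: "k \<in> {1..K}" "i \<in> {1..b t k}"
    if "Sample k i \<in> sources K (b t) \<or> Clutter k i \<in> sources K (b t) \<or>
      Sensing_Noise k i \<in> sources K (b t)" for k i
    using that by (auto simp: sources_def)
  interpret noisy_batch M K "b t" \<gamma> h g "x t" "c t" "n\<^sub>s t" "n\<^sub>u t" A "1 / B" "1 / sqrt (\<eta> t)"
    "\<lambda>k. 1 / sqrt (P t k)"
  proof unfold_locales
    show "norm (h y) \<le> A" for y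
      unfolding h_def by (rule hessian_bound)
  qed (use \<gamma>_borel h_borel in \<open>auto intro!: sample_meas \<gamma>_sq \<gamma>_mean independent source_indices
      gaussian_vector_moments[OF clutter_gaussian] gaussian_vector_moments[OF sensing_noise_gaussian]
      gaussian_vector_moments[OF channel_noise_gaussian]\<close>)
  define \<epsilon> where "\<epsilon> \<omega> = (\<Sum>j\<in>sources K (b t). err j \<omega>)" for \<omega>
  define V where "V = \<delta>\<^sub>u\<^sup>2 / \<eta> t + (\<Sum>k=1..K. real (b t k) / B\<^sup>2 *
      (\<sigma>\<^sup>2 + A\<^sup>2 * ((\<delta>\<^sub>c k)\<^sup>2 + \<delta>\<^sub>s\<^sup>2 / P t k)))"
  have recovered: "recovered_gradient K (b t) (P t) (\<eta> t) f (\<lambda>k. w\<^sub>l t k \<omega>)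
      (\<lambda>k i. x t k i \<omega>) (\<lambda>k i. c t k i \<omega>) (\<lambda>k i. n\<^sub>s t k i \<omega>) (n\<^sub>u t \<omega>) = g + \<epsilon> \<omega>"
    if \<omega>: "\<omega> \<in> space M" for \<omega>
  proof -
    let ?noise = "\<lambda>k i. h (x t k i \<omega>) *v (c t k i \<omega> + (1 / sqrt (P t k)) *\<^sub>R n\<^sub>s t k i \<omega>)"
    \<comment> \<open>One share \<open>1 / B\<close> of \<open>g\<close> per sample: the shares add
      up to \<open>g\<close> because the total batch is nonempty.\<close>
    have "(\<Sum>k=1..K. \<Sum>i=1..b t k. (1 / B) *\<^sub>R g) = (\<Sum>k=1..K. real (b t k)) *\<^sub>R (1 / B) *\<^sub>R g"
      by (simp add: sum_constant_scaleR scaleR_sum_left sum_divide_distrib del: sum_constant)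
    also have "\<dots> = g"
      using B by (simp add: B_def total_batch_def)
    finally have g: "(\<Sum>k=1..K. \<Sum>i=1..b t k. (1 / B) *\<^sub>R g) = g" .
    have "(1 / B) *\<^sub>R (\<gamma> (x t k i \<omega>) + ?noise k i) = (1 / B) *\<^sub>R g +
        (err (Sample k i) \<omega> + err (Clutter k i) \<omega> + err (Sensing_Noise k i) \<omega>)" for k i
      by (simp add: err_def matrix_vector_right_distrib matrix_vector_mult_scaleR
          scaleR_diff_right scaleR_add_right)
    then have "(1 / B) *\<^sub>R (\<Sum>k=1..K. \<Sum>i=1..b t k. \<gamma> (x t k i \<omega>) + ?noise k i) =
        (\<Sum>k=1..K. \<Sum>i=1..b t k. (1 / B) *\<^sub>R g +
          (err (Sample k i) \<omega> + err (Clutter k i) \<omega> + err (Sensing_Noise k i) \<omega>))"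
      by (simp only: scaleR_sum_right)
    also have "\<dots> = g + (\<Sum>k=1..K. \<Sum>i=1..b t k. err (Sample k i) \<omega> + err (Clutter k i) \<omega> + err (Sensing_Noise k i) \<omega>)"
      by (simp only: sum.distrib g)
    finally have "(1 / B) *\<^sub>R (\<Sum>k=1..K. \<Sum>i=1..b t k. \<gamma> (x t k i \<omega>) + ?noise k i) =
        g + (\<Sum>k=1..K. \<Sum>i=1..b t k. err (Sample k i) \<omega> + err (Clutter k i) \<omega> + err (Sensing_Noise k i) \<omega>)" .
    moreover have "(\<Sum>k=1..K. \<Sum>i=1..b t k. grad (\<lambda>v. f v (x t k i \<omega>)) (w\<^sub>l t k \<omega>) +
          mixed_hessian f (w\<^sub>l t k \<omega>) (x t k i \<omega>) *v (c t k i \<omega> + (1 / sqrt (P t k)) *\<^sub>R n\<^sub>s t k i \<omega>)) =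
        (\<Sum>k=1..K. \<Sum>i=1..b t k. \<gamma> (x t k i \<omega>) + ?noise k i)"
      by (intro sum.cong refl) (simp add: local_model[OF _ \<omega>] \<gamma>_def h_def)
    ultimately show ?thesis
      unfolding recovered_gradient_def \<epsilon>_def sum_sources B_def[symmetric]
      by (simp add: err_def[of Channel_Noise])
  qed
  have V: "expectation (\<lambda>\<omega>. (norm (\<epsilon> \<omega>))\<^sup>2) \<le> V"
  proof -
    have "expectation (\<lambda>\<omega>. (norm (\<epsilon> \<omega>))\<^sup>2) \<le> (1 / sqrt (\<eta> t))\<^sup>2 * \<delta>\<^sub>u\<^sup>2 +
        (\<Sum>k=1..K. real (b t k) * (1 / B)\<^sup>2 *
          (\<sigma>\<^sup>2 + A\<^sup>2 * ((\<delta>\<^sub>c k)\<^sup>2 + (1 / sqrt (P t k))\<^sup>2 * \<delta>\<^sub>s\<^sup>2)))"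
      unfolding \<epsilon>_def
    proof (rule sum_err_second_moment_le)
      fix k i
      show "Sample k i \<in> sources K (b t) \<Longrightarrow> expectation (\<lambda>\<omega>. (norm (\<gamma> (x t k i \<omega>) - g))\<^sup>2) \<le> \<sigma>\<^sup>2"
        by (intro \<gamma>_var source_indices) auto
      show "Clutter k i \<in> sources K (b t) \<Longrightarrow> expectation (\<lambda>\<omega>. (norm (c t k i \<omega>))\<^sup>2) \<le> (\<delta>\<^sub>c k)\<^sup>2"
        by (intro eq_refl clutter_power source_indices) auto
      show "Sensing_Noise k i \<in> sources K (b t) \<Longrightarrow> expectation (\<lambda>\<omega>. (norm (n\<^sub>s t k i \<omega>))\<^sup>2) \<le> \<delta>\<^sub>s\<^sup>2"
        by (intro eq_refl sensing_noise_power source_indices) auto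
    qed (simp add: channel_noise_power)
    \<comment> \<open>Positive powers let the squares cancel the roots in
      \<open>1 / sqrt (\<eta> t)\<close> and \<open>1 / sqrt (P t k)\<close>.\<close>
    also have "\<dots> = V"
      unfolding V_def using receive_power sensing_power
      by (intro arg_cong2[where f = "(+)"] sum.cong refl)
        (simp_all add: power_divide less_imp_le)
    finally show ?thesis .
  qed
  \<comment> \<open>The origin of the prefactor: one \<open>L\<close> of the smoothness constant
    cancels against \<open>L\<^sup>2\<close> in the squared learning rate.\<close>
  have step: "L * (\<alpha> t)\<^sup>2 / 2 = 1 / (2 * real T * L)"
    using L_pos rounds by (simp add: learning_rate power_divide power_mult_distrib power2_eq_square[of L])
  have "(\<alpha> t - L * (\<alpha> t)\<^sup>2 / 2) * (norm g)\<^sup>2 - L * (\<alpha> t)\<^sup>2 / 2 * V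
      \<le> expectation (\<lambda>\<omega>. F w\<^sub>t - F (w\<^sub>t - \<alpha> t *\<^sub>R (g + \<epsilon> \<omega>)))"
  proof (rule expected_descent)
    show "F \<in> borel_measurable borel"
      by (rule borel_measurable_differentiable[OF loss_diff])
    show "F v \<le> F w\<^sub>t + inner (v - w\<^sub>t) g + L / 2 * (norm (v - w\<^sub>t))\<^sup>2" for v
      unfolding g_def by (rule smooth)
    show "square_int M \<epsilon>" "expectation \<epsilon> = 0"
      using sum_err_moments(1,2) by (simp_all add: \<epsilon>_def[abs_def])
  qed (use bounded_below L_pos V in auto)
  also have "expectation (\<lambda>\<omega>. F w\<^sub>t - F (w\<^sub>t - \<alpha> t *\<^sub>R (g + \<epsilon> \<omega>)))
      = expectation (\<lambda>\<omega>. F (w t \<omega>) - F (w (Suc t) \<omega>))"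
    by (rule Bochner_Integration.integral_cong) (simp_all add: update recovered current_model)
  finally show ?thesis
    unfolding step by (simp add: learning_rate g_def V_def B_def)
qed

end
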